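(* Let $[a,b]$ be a compact interval of $\mathbb{R}$ and $1\le p<\infty$. Let $m\ge1$ be an integer, let $\lambda_1>0$ and $\lambda_k\ge 0$ for $2\le k\le m$ be real numbers, and let $F\in\mathcal{F}^{p}_{op}([a,b])$. Consider the equation $$\lambda_1 f+\lambda_2 f^2+\cdots+\lambda_m f^m=F\quad\text{on } [a,b]. \qquad ( * )$$ (i) If $f,g\in\mathcal{F}^{p}_{op}([a,b])$ satisfy $( * )$ and $f\trianglelefteq g$, then $f=g$ on $[a,b]$. (ii) If $f,g\in\mathcal{F}^{p}_{op}([a,b])$ are solutions of $( * )$ such that $f$ subcommutes with $g$ and $f(x)<g(x)$ for some $x\in[a,b]$, then $f=g$ on $[a,b]$. (iii) If $f,g\in\mathcal{F}^{p}_{op}([a,b])$ satisfy $( * )$ and $f\circ g=g\circ f$, then $f=g$ on $[a,b]$.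
   Context: $\mathbb{R}$ carries its usual order. $\mathcal{F}_{op}([a,b])$ is the set of all order-preserving (non-decreasing) self-maps $f:[a,b]\to[a,b]$, with $f\trianglelefteq g$ iff $f(x)\le g(x)$ for all $x\in[a,b]$. $L_p([a,b])$ here denotes the set of all self-maps $f:[a,b]\to[a,b]$ that are Lebesgue measurable with $\int_a^b|f|^p\,d\mu<\infty$ ($\mu$ Lebesgue measure; no identification of almost-everywhere equal functions), and $\mathcal{F}^{p}_{op}([a,b]):=\mathcal{F}_{op}([a,b])\cap L_p([a,b])$. $f$ subcommutes with $g$ if $f\circ g\trianglelefteq g\circ f$. $f^k$ denotes the $k$-th iterate of $f$ (composition); sums and scalar multiples are pointwise. *)

theory Defs
  imports "HOL-Analysis.Analysis"
begin

text \<open>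
  A self-map of [a,b] is represented by a function on the reals that maps {a..b} into itself;
  its values outside {a..b} are arbitrary. Hence all relations between self-maps, including
  equality, are relative to the interval.
\<close>

definition le_on :: "real set \<Rightarrow> (real \<Rightarrow> real) \<Rightarrow> (real \<Rightarrow> real) \<Rightarrow> bool" where
  "le_on S f g \<longleftrightarrow> (\<forall>x\<in>S. f x \<le> g x)"

definition eq_on :: "real set \<Rightarrow> (real \<Rightarrow> real) \<Rightarrow> (real \<Rightarrow> real) \<Rightarrow> bool" where
  "eq_on S f g \<longleftrightarrow> (\<forall>x\<in>S. f x = g x)"

definition subcommutes_on :: "real set \<Rightarrow> (real \<Rightarrow> real) \<Rightarrow> (real \<Rightarrow> real) \<Rightarrow> bool" where
  "subcommutes_on S f g \<longleftrightarrow> le_on S (f \<circ> g) (g \<circ> f)"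

definition F_op :: "real \<Rightarrow> real \<Rightarrow> (real \<Rightarrow> real) set" where
  "F_op a b = {f. f \<in> {a..b} \<rightarrow> {a..b} \<and> mono_on {a..b} f}"

definition L_self :: "real \<Rightarrow> real \<Rightarrow> real \<Rightarrow> (real \<Rightarrow> real) set" where
  "L_self p a b = {f. f \<in> {a..b} \<rightarrow> {a..b}
     \<and> f \<in> borel_measurable (lebesgue_on {a..b})
     \<and> integrable (lebesgue_on {a..b}) (\<lambda>x. \<bar>f x\<bar> powr p)}"

definition F_op_p :: "real \<Rightarrow> real \<Rightarrow> real \<Rightarrow> (real \<Rightarrow> real) set" where
  "F_op_p p a b = F_op a b \<inter> L_self p a b"

definition solves_iterative_eq ::
  "real \<Rightarrow> real \<Rightarrow> nat \<Rightarrow> (nat \<Rightarrow> real) \<Rightarrow> (real \<Rightarrow> real) \<Rightarrow> (real \<Rightarrow> real) \<Rightarrow> bool" where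
  "solves_iterative_eq a b m c F f \<longleftrightarrow>
     eq_on {a..b} (\<lambda>x. \<Sum>k = 1..m. c k * (f ^^ k) x) F"

end

theory Submission
  imports Defs
begin

text \<open>
  All coefficients are nonnegative and the first one is positive. So if \<open>f\<^sup>k x \<le> g\<^sup>k x\<close> for all \<open>k\<close>,
  equality of the two weighted sums at \<open>x\<close> forces \<open>f x = g x\<close>. If \<open>f\<close> subcommutes with \<open>g\<close>, these
  inequalities at a given point \<open>x\<close> already follow from \<open>f x \<le> g x\<close>. Hence the hypotheses of
  part (ii) are contradictory, and part (iii) applies this to \<open>(f, g)\<close> and \<open>(g, f)\<close>.
\<close>

lemma funpow_in:
  assumes "f \<in> S \<rightarrow> S" "x \<in> S"
  shows "(f ^^ k) x \<in> S"
  using assms by (induction k) auto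

text \<open>Induction on \<open>k\<close>: compare \<open>f\<close> with \<open>g\<close> at the
  common point \<open>(f ^^ k) x\<close>, then use monotonicity of \<open>g\<close> to replace that
  point by \<open>(g ^^ k) x\<close>. This serves part (i).\<close>

lemma funpow_le_on:
  fixes f g :: "real \<Rightarrow> real"
  assumes f: "f \<in> S \<rightarrow> S" and g: "g \<in> S \<rightarrow> S" and "mono_on S g"
    and le: "le_on S f g" and x: "x \<in> S"
  shows "(f ^^ k) x \<le> (g ^^ k) x"
proof (induction k)
  case (Suc k)
  have "f ((f ^^ k) x) \<le> g ((f ^^ k) x)"
    using le funpow_in[OF f x] by (simp add: le_on_def)
  also have "\<dots> \<le> g ((g ^^ k) x)"
    using mono_onD[OF \<open>mono_on S g\<close> funpow_in[OF f x] funpow_in[OF g x] Suc] .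
  finally show ?case by simp
qed simp

text \<open>Subcommutation carries \<open>g\<close> outward past one \<open>f\<close> at a time;
  monotonicity of \<open>f\<close> allows the induction hypothesis to be used under the outermost
  \<open>f\<close>.\<close>

lemma subcommutes_on_funpow:
  assumes f: "f \<in> S \<rightarrow> S" and g: "g \<in> S \<rightarrow> S" and "mono_on S f"
    and sub: "subcommutes_on S f g" and x: "x \<in> S"
  shows "(f ^^ k) (g x) \<le> g ((f ^^ k) x)"
proof (induction k)
  case (Suc k)
  have "f ((f ^^ k) (g x)) \<le> f (g ((f ^^ k) x))"
    using funpow_in[OF f] x g by (intro mono_onD[OF \<open>mono_on S f\<close> _ _ Suc]) auto
  also have "\<dots> \<le> g (f ((f ^^ k) x))"
    using sub funpow_in[OF f x] by (simp add: subcommutes_on_def le_on_def)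
  finally show ?case by simp
qed simp

lemma mono_on_funpow:
  fixes f :: "real \<Rightarrow> real"
  assumes "f \<in> S \<rightarrow> S" "mono_on S f"
  shows "mono_on S (f ^^ k)"
proof (induction k)
  case (Suc k)
  have "f ((f ^^ k) x) \<le> f ((f ^^ k) y)" if "x \<in> S" "y \<in> S" "x \<le> y" for x y
    using mono_onD[OF assms(2) _ _ mono_onD[OF Suc that]] funpow_in[OF assms(1)] that by blast
  then show ?case by (auto intro: mono_onI)
qed (simp add: mono_on_def)

text \<open>The maps are compared only at \<open>x\<close>, not at its iterates, so the outermost
  \<open>f\<close> cannot simply be replaced by \<open>g\<close>. Instead the innermost
  \<open>f\<close> is replaced, and the resulting \<open>g\<close> is then moved to the
  outside.\<close>

lemma subcommutes_on_funpow_le: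
  assumes f: "f \<in> S \<rightarrow> S" and g: "g \<in> S \<rightarrow> S" and "mono_on S f" "mono_on S g"
    and sub: "subcommutes_on S f g" and x: "x \<in> S" and "f x \<le> g x"
  shows "(f ^^ k) x \<le> (g ^^ k) x"
proof (induction k)
  case (Suc k)
  \<comment> \<open>Exposes the innermost application, the one place where
    \<open>f x \<le> g x\<close> applies.\<close>
  have "(f ^^ Suc k) x = (f ^^ k) (f x)"
    by (simp only: funpow_Suc_right comp_apply)
  also have "\<dots> \<le> (f ^^ k) (g x)"
    using f g x by (intro mono_onD[OF mono_on_funpow[OF f \<open>mono_on S f\<close>] _ _ \<open>f x \<le> g x\<close>]) auto
  also have "\<dots> \<le> g ((f ^^ k) x)"
    using subcommutes_on_funpow[OF f g \<open>mono_on S f\<close> sub x] .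
  also have "\<dots> \<le> g ((g ^^ k) x)"
    using mono_onD[OF \<open>mono_on S g\<close> funpow_in[OF f x] funpow_in[OF g x] Suc] .
  finally show ?case by simp
qed simp

lemma solves_iterative_eq_unique_at:
  assumes "1 \<le> m" and pos: "c 1 > 0"
    and nonneg: "\<And>k. 2 \<le> k \<Longrightarrow> k \<le> m \<Longrightarrow> c k \<ge> 0"
    and f: "solves_iterative_eq a b m c F f" and g: "solves_iterative_eq a b m c F g"
    and x: "x \<in> {a..b}" and le: "\<And>k. (f ^^ k) x \<le> (g ^^ k) x"
  shows "f x = g x"
proof (rule ccontr)
  assume "f x \<noteq> g x"
  with le[of 1] have "f x < g x" by simp
  have "c k \<ge> 0" if "k \<in> {1..m}" for k
    using that pos nonneg[of k] by (cases "k = 1") auto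
  then have "\<forall>k\<in>{1..m}. c k * (f ^^ k) x \<le> c k * (g ^^ k) x"
    using le by (auto intro: mult_left_mono)
  \<comment> \<open>The strict term is the one at index 1, which lies in the range since
    \<open>1 \<le> m\<close>.\<close>
  moreover have "\<exists>k\<in>{1..m}. c k * (f ^^ k) x < c k * (g ^^ k) x"
    using \<open>f x < g x\<close> pos \<open>1 \<le> m\<close> by (intro bexI[of _ 1]) auto
  ultimately have "(\<Sum>k = 1..m. c k * (f ^^ k) x) < (\<Sum>k = 1..m. c k * (g ^^ k) x)"
    by (intro sum_strict_mono_ex1) auto
  then show False
    using f g x by (simp add: solves_iterative_eq_def eq_on_def)
qed

theorem corollary2:
  fixes a b p :: real and m :: nat and c :: "nat \<Rightarrow> real" and F :: "real \<Rightarrow> real"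
  assumes "a \<le> b"
    and "1 \<le> p"
    and "1 \<le> m"
    and "c 1 > 0"
    and "\<And>k. 2 \<le> k \<Longrightarrow> k \<le> m \<Longrightarrow> c k \<ge> 0"
    and "F \<in> F_op_p p a b"
  shows "(\<forall>f\<in>F_op_p p a b. \<forall>g\<in>F_op_p p a b.
            solves_iterative_eq a b m c F f \<longrightarrow> solves_iterative_eq a b m c F g \<longrightarrow>
            le_on {a..b} f g \<longrightarrow> eq_on {a..b} f g)
       \<and> (\<forall>f\<in>F_op_p p a b. \<forall>g\<in>F_op_p p a b.
            solves_iterative_eq a b m c F f \<longrightarrow> solves_iterative_eq a b m c F g \<longrightarrow>
            subcommutes_on {a..b} f g \<longrightarrow> (\<exists>x\<in>{a..b}. f x < g x) \<longrightarrow> eq_on {a..b} f g)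
       \<and> (\<forall>f\<in>F_op_p p a b. \<forall>g\<in>F_op_p p a b.
            solves_iterative_eq a b m c F f \<longrightarrow> solves_iterative_eq a b m c F g \<longrightarrow>
            eq_on {a..b} (f \<circ> g) (g \<circ> f) \<longrightarrow> eq_on {a..b} f g)"
proof -
  have F_opD: "f \<in> {a..b} \<rightarrow> {a..b}" "mono_on {a..b} f" if "f \<in> F_op_p p a b" for f
    using that by (simp_all add: F_op_p_def F_op_def)
  have le: "eq_on {a..b} f g"
    if "f \<in> F_op_p p a b" "g \<in> F_op_p p a b" "solves_iterative_eq a b m c F f"
      "solves_iterative_eq a b m c F g" "le_on {a..b} f g" for f g
    unfolding eq_on_def
  proof
    fix x assume x: "x \<in> {a..b}"
    have "(f ^^ k) x \<le> (g ^^ k) x" for k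
      using funpow_le_on[OF F_opD(1)[OF that(1)] F_opD[OF that(2)] that(5) x] .
    then show "f x = g x"
      using solves_iterative_eq_unique_at[OF assms(3-5) that(3,4) x] by blast
  qed
  \<comment> \<open>This pointwise bound refutes the strict inequality assumed in part (ii). Used in
    both directions, it gives part (iii) by antisymmetry.\<close>
  have sub: "g x \<le> f x"
    if "f \<in> F_op_p p a b" "g \<in> F_op_p p a b" "solves_iterative_eq a b m c F f"
      "solves_iterative_eq a b m c F g" "subcommutes_on {a..b} f g" "x \<in> {a..b}" for f g x
  proof (rule ccontr)
    assume less: "\<not> g x \<le> f x"
    have "(f ^^ k) x \<le> (g ^^ k) x" for k
      using subcommutes_on_funpow_le[OF F_opD(1)[OF that(1)] F_opD(1)[OF that(2)]
          F_opD(2)[OF that(1)] F_opD(2)[OF that(2)] that(5,6)] less by simp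
    then show False
      using solves_iterative_eq_unique_at[OF assms(3-5) that(3,4,6)] less by simp
  qed
  have comm: "eq_on {a..b} f g"
    if "f \<in> F_op_p p a b" "g \<in> F_op_p p a b" "solves_iterative_eq a b m c F f"
      "solves_iterative_eq a b m c F g" "eq_on {a..b} (f \<circ> g) (g \<circ> f)" for f g
  proof -
    have "subcommutes_on {a..b} f g" "subcommutes_on {a..b} g f"
      using that(5) by (auto simp: subcommutes_on_def le_on_def eq_on_def)
    then show ?thesis
      using sub[of f g] sub[of g f] that by (auto simp: eq_on_def intro: antisym)
  qed
  show ?thesis
  proof (intro conjI ballI impI)
    fix f g
    assume "f \<in> F_op_p p a b" "g \<in> F_op_p p a b" "solves_iterative_eq a b m c F f"
      "solves_iterative_eq a b m c F g" "subcommutes_on {a..b} f g" "\<exists>x\<in>{a..b}. f x < g x"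
    \<comment> \<open>The bound \<open>sub\<close> at the witness \<open>x\<close> contradicts
      \<open>f x < g x\<close>, so the goal holds vacuously.\<close>
    then show "eq_on {a..b} f g"
      using sub[of f g] by fastforce
  qed (fact le comm)+
qed

end
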